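(* Consider algorithm TRIEST-BASE (described in the context) run with integer parameter $M\ge 6$ on an insertion-only edge stream. Let $t\ge 0$ and assume $|\Delta^{(t)}|>0$. For any $\varepsilon,\delta\in(0,1)$, let \[ \Phi=\sqrt[3]{8\varepsilon^{-2}\frac{3h^{(t)}+1}{|\Delta^{(t)}|}\ln\left(\frac{(3h^{(t)}+1)e}{\delta}\right)}. \] If \[ M\ge\max\left\{t\Phi\left(1+\tfrac{1}{2}\ln^{2/3}(t\Phi)\right),\ 12\varepsilon^{-1}+e^2,\ 25\right\}, \] then $\left|\xi^{(t)}\tau^{(t)}-|\Delta^{(t)}|\right|<\varepsilon|\Delta^{(t)}|$ with probability $>1-\delta$.
   Context: An insertion-only edge stream: at each time step $t=1,2,\dots$ an edge $e_t=\{u,v\}$ between two distinct vertices arrives, which is not already present; $G^{(t)}=(V^{(t)},E^{(t)})$ with $E^{(t)}=\{e_1,\dots,e_t\}$. A triangle in $G^{(t)}$ is a set of three edges $\{\{u,v\},\{v,w\},\{w,u\}\}\subseteq E^{(t)}$ with $u,v,w$ distinct; $\Delta^{(t)}$ is the set of all triangles of $G^{(t)}$, and $h^{(t)}$ is the maximum, over edges $e\in E^{(t)}$, of the number of triangles of $G^{(t)}$ containing $e$. TRIEST-BASE maintains an edge sample $\mathcal{S}$ (initially empty) by reservoir sampling with capacity $M$: at time $t$, if $t\le M$ the edge $e_t$ is inserted into $\mathcal{S}$; if $t>M$, with probability $M/t$ an edge chosen uniformly at random from $\mathcal{S}$ is removed and then $e_t$ is inserted, otherwise $\mathcal{S}$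 is unchanged. It maintains a counter $\tau$ (initially $0$): immediately after an edge $\{u,v\}$ is inserted into (resp. removed from) $\mathcal{S}$, $\tau$ is increased (resp. decreased) by the number of vertices $c$ such that both $\{c,u\}$ and $\{c,v\}$ are in the current $\mathcal{S}$. $\tau^{(t)}$ is the value of $\tau$ at the end of time step $t$. For positive integers $a\le\min\{M,b\}$, $\xi_{a,b}=1$ if $b\le M$ and $\xi_{a,b}=\prod_{i=0}^{a-1}\frac{b-i}{M-i}$ otherwise; $\xi^{(t)}=\xi_{3,t}$. *)

theory Defs
  imports "HOL-Probability.Probability"
begin

text \<open>Edges are two-element vertex sets; an edge stream prefix e_1,...,e_t is a list.\<close>

definition valid_stream :: "'v set list \<Rightarrow> bool" where
  "valid_stream es \<longleftrightarrow> distinct es \<and> (\<forall>e\<in>set es. \<exists>u v. u \<noteq> v \<and> e = {u, v})"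

definition triangles :: "'v set set \<Rightarrow> 'v set set set" where
  "triangles E = {T. \<exists>u v w. u \<noteq> v \<and> v \<noteq> w \<and> w \<noteq> u \<and>
      T = {{u, v}, {v, w}, {w, u}} \<and> T \<subseteq> E}"

definition max_tri_per_edge :: "'v set set \<Rightarrow> nat" where
  "max_tri_per_edge E = Max ((\<lambda>e. card {T \<in> triangles E. e \<in> T}) ` E)"

definition common_nb :: "'v set set \<Rightarrow> 'v set \<Rightarrow> nat" where
  "common_nb S e = card {c. \<exists>u v. e = {u, v} \<and> u \<noteq> v \<and> {c, u} \<in> S \<and> {c, v} \<in> S}"

text \<open>One step of TRIEST-BASE at time t (1-indexed) with arriving edge e, state (S, tau).\<close>
definition triest_step :: "nat \<Rightarrow> nat \<Rightarrow> 'v set \<Rightarrow> 'v set set \<times> int \<Rightarrow> ('v set set \<times> int) pmf" where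
  "triest_step M t e st =
     (case st of (S, \<tau>) \<Rightarrow>
       (if t \<le> M then
          (let S' = insert e S in return_pmf (S', \<tau> + int (common_nb S' e)))
        else
          do { b \<leftarrow> bernoulli_pmf (real M / real t);
               if b then
                 do { f \<leftarrow> pmf_of_set S;
                      let S1 = S - {f};
                      let \<tau>1 = \<tau> - int (common_nb S1 f);
                      let S2 = insert e S1;
                      return_pmf (S2, \<tau>1 + int (common_nb S2 e)) }
               else return_pmf (S, \<tau>) }))"

definition triest_base :: "nat \<Rightarrow> 'v set list \<Rightarrow> ('v set set \<times> int) pmf" where
  "triest_base M es =
     foldl (\<lambda>p (t, e). bind_pmf p (triest_step M t e))
           (return_pmf ({}, 0)) (zip [1..<Suc (length es)] es)"

definition xi_ab :: "nat \<Rightarrow> nat \<Rightarrow> nat \<Rightarrow> real" where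
  "xi_ab M a b = (if b \<le> M then 1 else (\<Prod>i<a. (real b - real i) / (real M - real i)))"

end

theory Submission
  imports Defs
begin

text \<open>
  The sample of TRIEST-BASE at time \<open>t > M\<close> is a uniform \<open>M\<close>-subset of the edges, and the counter is the
  number of triangles inside it; it has mean \<open>|\<Delta>| / \<xi>\<close> exactly. For pairwise disjoint triangles the events
  of being sampled are negatively associated, so the exponential moments of their number are dominated
  by those of a binomial variable, on both sides. A greedy colouring splits all triangles into
  \<open>K = 3 h + 1\<close> classes of pairwise disjoint ones, and the classes are recombined by Jensen's inequality.
  This yields the tail bound \<open>2 exp (- \<epsilon>\<^sup>2 |\<Delta>| / (16 \<xi> K))\<close>; the assumption on \<open>M\<close> gives
  \<open>M \<ge> 3/2 t \<Phi>\<close>, which suffices.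
\<close>

section \<open>Averages over subsets of fixed size, and negative association\<close>

abbreviation subsets_of_card :: "nat \<Rightarrow> 'a set \<Rightarrow> 'a set set" where
  "subsets_of_card m E \<equiv> {S. S \<subseteq> E \<and> card S = m}"

text \<open>The expectation of \<open>G\<close> at a uniform \<open>m\<close>-subset of a finite set
  \<open>E\<close>, as a finite sum, so that comparisons become double counting. For
  \<open>m > card E\<close> both sum and denominator vanish and the value is 0.\<close>

definition avg :: "nat \<Rightarrow> 'a set \<Rightarrow> ('a set \<Rightarrow> real) \<Rightarrow> real" where
  "avg m E G = (\<Sum>S\<in>subsets_of_card m E. G S) / real (card E choose m)"

text \<open>Pascal's rule with weights: split by whether \<open>x\<close> belongs to the
  subset.\<close>

lemma sum_subsets_of_card_insert:
  fixes G :: "'a set \<Rightarrow> real"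
  assumes "finite E" "x \<notin> E"
  shows "(\<Sum>S\<in>subsets_of_card (Suc m) (insert x E). G S) =
         (\<Sum>S\<in>subsets_of_card (Suc m) E. G S) + (\<Sum>S\<in>subsets_of_card m E. G (insert x S))"
proof -
  have eq: "subsets_of_card (Suc m) (insert x E) =
        subsets_of_card (Suc m) E \<union> insert x ` subsets_of_card m E" (is "?L = ?R")
  proof
    show "?L \<subseteq> ?R"
    proof
      fix S assume S: "S \<in> ?L"
      then have "finite S" using assms by (auto intro: finite_subset)
      show "S \<in> ?R"
      proof (cases "x \<in> S")
        case True
        then have "S = insert x (S - {x})" "card (S - {x}) = m" "S - {x} \<subseteq> E"
          using S \<open>finite S\<close> by auto
        then show ?thesis by blast
      qed (use S in auto)
    qed
    show "?R \<subseteq> ?L"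
    proof
      fix S assume "S \<in> ?R"
      then consider "S \<in> subsets_of_card (Suc m) E"
        | A where "A \<in> subsets_of_card m E" "S = insert x A" by blast
      then show "S \<in> ?L"
      proof cases
        case 2
        then have "finite A" "x \<notin> A" using assms by (auto intro: finite_subset)
        then show ?thesis using 2 by auto
      qed auto
    qed
  qed
  have inj: "inj_on (insert x) (subsets_of_card m E)"
    using assms(2) by (auto simp: inj_on_def)
  have "subsets_of_card (Suc m) E \<inter> insert x ` subsets_of_card m E = {}"
    using assms(2) by auto
  then show ?thesis
    unfolding eq using assms(1) inj by (simp add: sum.union_disjoint sum.reindex)
qed

text \<open>Adding a uniform new element to a uniform \<open>m\<close>-subset yields a uniform
  \<open>Suc m\<close>-subset, and a monotone \<open>G\<close> does not decrease on the way.
  Formally, pairs \<open>(S, y)\<close> with \<open>y\<close> outside \<open>S\<close> are matched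
  with pairs \<open>(insert y S, y)\<close>, and the absorption identity for binomials aligns the
  two normalising factors.\<close>

lemma avg_mono_card:
  assumes "finite E" "m < card E" "mono G"
  shows "avg m E G \<le> avg (Suc m) E G"
proof -
  let ?U = "\<lambda>m. subsets_of_card m E" and ?n = "card E"
  have fin: "finite (?U m)" "finite (?U (Suc m))" using assms(1) by simp_all
  have finS: "finite S" if "S \<subseteq> E" for S using that assms(1) finite_subset by blast
  have "real (?n - m) * (\<Sum>S\<in>?U m. G S) = (\<Sum>S\<in>?U m. \<Sum>y\<in>E - S. G S)"
    by (auto simp: sum_distrib_left card_Diff_subset finS intro!: sum.cong)
  also have "\<dots> \<le> (\<Sum>S\<in>?U m. \<Sum>y\<in>E - S. G (insert y S))"
    by (intro sum_mono monoD[OF assms(3)]) auto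
  also have "\<dots> = (\<Sum>(S, y)\<in>(SIGMA S:?U m. E - S). G (insert y S))"
    using assms(1) fin by (subst sum.Sigma) auto
  also have "\<dots> = (\<Sum>(S, y)\<in>(SIGMA S:?U (Suc m). S). G S)"
    by (rule sum.reindex_bij_witness[where j = "\<lambda>(S, y). (insert y S, y)" and i = "\<lambda>(S, y). (S - {y}, y)"])
       (auto simp: finS card_insert_if)
  also have "\<dots> = (\<Sum>S\<in>?U (Suc m). \<Sum>y\<in>S. G S)"
    using fin finS by (subst sum.Sigma) auto
  also have "\<dots> = real (Suc m) * (\<Sum>S\<in>?U (Suc m). G S)"
    by (auto simp: sum_distrib_left intro!: sum.cong)
  finally have le: "real (?n - m) * (\<Sum>S\<in>?U m. G S) \<le> real (Suc m) * (\<Sum>S\<in>?U (Suc m). G S)" .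
  have "Suc m * (?n choose Suc m) = (?n - m) * (?n choose m)"
    by (simp only: binomial_absorption binomial_absorb_comp)
  then have "real (Suc m) * real (?n choose Suc m) = real (?n - m) * real (?n choose m)"
    by (simp only: of_nat_mult[symmetric])
  moreover have "real (?n choose m) > 0" "real (?n choose Suc m) > 0" "real (?n - m) > 0"
    using assms(2) by simp_all
  moreover have "avg m E G = (real (?n - m) * (\<Sum>S\<in>?U m. G S)) / (real (?n - m) * real (?n choose m))"
    using assms(2) by (simp add: avg_def)
  moreover have "avg (Suc m) E G = (real (Suc m) * (\<Sum>S\<in>?U (Suc m). G S)) / (real (Suc m) * real (?n choose Suc m))"
    by (simp add: avg_def del: of_nat_Suc)
  ultimately show ?thesis
    using divide_right_mono[OF le, of "real (?n - m) * real (?n choose m)"] by simp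
qed

text \<open>A \<open>Suc m\<close>-subset of \<open>insert x E\<close> either contains
  \<open>x\<close>, and the rest is an \<open>m\<close>-subset of \<open>E\<close>, or it is a
  \<open>Suc m\<close>-subset of \<open>E\<close>, to which \<open>avg_mono_card\<close> applies.
  Each part has average at least \<open>avg m E G\<close>; for \<open>m = card E\<close> the second
  part is empty.\<close>

lemma avg_mono_insert:
  assumes "finite E" "x \<notin> E" "m \<le> card E" "mono G"
  shows "avg m E G \<le> avg (Suc m) (insert x E) G"
proof -
  let ?n = "card E"
  have c: "real (?n choose m) > 0" using assms(3) by simp
  have 1: "real (?n choose m) * avg m E G \<le> (\<Sum>S\<in>subsets_of_card m E. G (insert x S))"
  proof -
    have "real (?n choose m) * avg m E G = (\<Sum>S\<in>subsets_of_card m E. G S)"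
      using c by (simp add: avg_def)
    also have "\<dots> \<le> (\<Sum>S\<in>subsets_of_card m E. G (insert x S))"
      by (intro sum_mono monoD[OF assms(4)]) auto
    finally show ?thesis .
  qed
  have 2: "real (?n choose Suc m) * avg m E G \<le> (\<Sum>S\<in>subsets_of_card (Suc m) E. G S)"
  proof (cases "m < ?n")
    case True
    then have "real (?n choose Suc m) * avg m E G \<le> real (?n choose Suc m) * avg (Suc m) E G"
      using avg_mono_card[OF assms(1) True assms(4)] by (intro mult_left_mono) auto
    also have "\<dots> = (\<Sum>S\<in>subsets_of_card (Suc m) E. G S)"
      using True by (simp add: avg_def)
    finally show ?thesis .
  next
    case False
    then have "card S \<noteq> Suc m" if "S \<subseteq> E" for S
      using card_mono[OF assms(1) that] by linarith
    then have "subsets_of_card (Suc m) E = {}" by blast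
    moreover have "?n choose Suc m = 0" using False by (simp add: binomial_eq_0)
    ultimately show ?thesis by (simp only: sum.empty of_nat_0 mult_zero_left order_refl)
  qed
  have "real (Suc ?n choose Suc m) * avg m E G \<le> (\<Sum>S\<in>subsets_of_card (Suc m) (insert x E). G S)"
    using 1 2 by (simp add: sum_subsets_of_card_insert[OF assms(1,2)] algebra_simps)
  moreover have "real (Suc ?n choose Suc m) > 0" using assms(3) by (simp del: binomial_Suc_Suc)
  ultimately show ?thesis
    using assms(1,2) by (simp add: avg_def field_simps del: binomial_Suc_Suc)
qed

text \<open>Compares a conditional with an unconditional average: once \<open>T\<close> is forced
  into a sample from \<open>E \<union> T\<close>, what remains is a uniform \<open>m\<close>-subset
  of \<open>E\<close>. The elements of \<open>T\<close> are put back one at a time.\<close>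

lemma avg_mono_Un:
  assumes "finite T" "finite E" "T \<inter> E = {}" "m \<le> card E" "mono G"
  shows "avg m E G \<le> avg (m + card T) (E \<union> T) G"
  using assms(1,3)
proof (induction T rule: finite_induct)
  case (insert x T)
  have "avg m E G \<le> avg (m + card T) (E \<union> T) G" using insert by auto
  also have "\<dots> \<le> avg (Suc (m + card T)) (insert x (E \<union> T)) G"
    using insert assms by (intro avg_mono_insert) (auto simp: card_Un_disjoint Int_commute)
  finally show ?case using insert by simp
qed simp

lemma avg_antimono_Un:
  assumes "finite T" "finite E" "T \<inter> E = {}" "m \<le> card E" "antimono G"
  shows "avg (m + card T) (E \<union> T) G \<le> avg m E G"
  using avg_mono_Un[of T E m "\<lambda>S. - G S"] assms
  by (auto simp: avg_def sum_negf mono_def antimono_def)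

text \<open>Removing \<open>T\<close> is a bijection from the \<open>m\<close>-subsets that contain
  \<open>T\<close> to the \<open>(m - card T)\<close>-subsets of \<open>E - T\<close>, and
  \<open>G\<close> does not notice the removal. This describes the sample conditioned on containing
  \<open>T\<close>.\<close>

lemma sum_subsets_of_card_supset:
  fixes G :: "'a set \<Rightarrow> real"
  assumes "finite E" "T \<subseteq> E" "card T \<le> m" "\<And>S. G (S \<union> T) = G S"
  shows "(\<Sum>S\<in>subsets_of_card m E. of_bool (T \<subseteq> S) * G S) = (\<Sum>S\<in>subsets_of_card (m - card T) (E - T). G S)"
proof -
  have fin: "finite T" "\<And>S. S \<subseteq> E \<Longrightarrow> finite S" using assms finite_subset by blast+
  have "(\<Sum>S\<in>subsets_of_card m E. of_bool (T \<subseteq> S) * G S) = (\<Sum>S\<in>{S. S \<subseteq> E \<and> card S = m \<and> T \<subseteq> S}. G S)"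
    using assms(1) by (intro sum.mono_neutral_cong_right) auto
  also have "\<dots> = (\<Sum>S\<in>subsets_of_card (m - card T) (E - T). G S)"
  proof (rule sum.reindex_bij_witness[where i = "\<lambda>S. S \<union> T" and j = "\<lambda>S. S - T"])
    fix S assume "S \<in> {S. S \<subseteq> E \<and> card S = m \<and> T \<subseteq> S}"
    then show "S - T \<in> subsets_of_card (m - card T) (E - T)" "G (S - T) = G S" "S - T \<union> T = S"
      using fin assms(4)[of "S - T"] by (auto simp: card_Diff_subset Un_absorb2)
  next
    fix S assume S: "S \<in> subsets_of_card (m - card T) (E - T)"
    then have "card (S \<union> T) = m"
      using fin assms(3) by (subst card_Un_disjoint) auto
    then show "S \<union> T \<in> {S. S \<subseteq> E \<and> card S = m \<and> T \<subseteq> S}" "S \<union> T - T = S"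
      using S assms(2) by auto
  qed
  finally show ?thesis .
qed

text \<open>The probability that a uniform \<open>m\<close>-subset of an \<open>n\<close>-set contains a given \<open>r\<close>-subset.\<close>

definition incl_prob :: "nat \<Rightarrow> nat \<Rightarrow> nat \<Rightarrow> real" where
  "incl_prob r m n = real (n - r choose (m - r)) / real (n choose m)"

lemma incl_prob_nonneg: "0 \<le> incl_prob r m n"
  by (simp add: incl_prob_def)

lemma incl_prob_le_1:
  assumes "r \<le> m" "m \<le> n"
  shows "incl_prob r m n \<le> 1"
proof -
  have "(a choose b) \<le> (a + r choose (b + r))" for a b
    by (induction r) (auto intro: le_trans)
  from this[of "n - r" "m - r"] have "(n - r choose (m - r)) \<le> (n choose m)"
    using assms by simp
  then show ?thesis using assms(2) by (simp add: incl_prob_def divide_le_eq_1)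
qed

text \<open>For disjoint sets the events \<open>T \<subseteq> S\<close> are negatively associated: conditioning on \<open>T \<subseteq> S\<close>
  leaves fewer sampled elements outside \<open>T\<close>.\<close>

lemma avg_prod_le:
  fixes F :: "'a set set" and a :: real
  assumes "finite E" "r \<le> m" "m \<le> card E" "- 1 \<le> a" "finite F" "disjoint F"
    and "\<And>T. T \<in> F \<Longrightarrow> T \<subseteq> E \<and> card T = r"
  shows "avg m E (\<lambda>S. \<Prod>T\<in>F. 1 + a * of_bool (T \<subseteq> S)) \<le>
         (1 + a * (incl_prob r m (card E))) ^ card F"
  using assms(5,6,7)
proof (induction F rule: finite_induct)
  case empty
  then show ?case using assms(1,3) by (simp add: avg_def n_subsets)
next
  case (insert T F)
  define G where "G S = (\<Prod>T\<in>F. 1 + a * of_bool (T \<subseteq> S))" for S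
  define q where "q = incl_prob r m (card E)"
  have T: "T \<subseteq> E" "card T = r" "finite T"
    using insert.prems assms(1) by (auto intro: finite_subset)
  have GT: "G (S \<union> T) = G S" for S
    unfolding G_def
  proof (intro prod.cong refl)
    fix T' assume "T' \<in> F"
    then have "T' \<inter> T = {}"
      using insert.prems(1) insert.hyps(2) by (auto simp: pairwise_insert disjnt_def)
    then show "1 + a * of_bool (T' \<subseteq> S \<union> T) = 1 + a * of_bool (T' \<subseteq> S)" by (auto simp: of_bool_def)
  qed
  have cC: "real (card E choose m) > 0" using assms(3) by simp
  have cET: "card (E - T) = card E - r" using T by (simp add: card_Diff_subset)
  have rn: "m - r \<le> card E - r" using assms(3) by auto
  have cond: "(\<Sum>S\<in>subsets_of_card m E. of_bool (T \<subseteq> S) * G S) / real (card E choose m)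
      = q * avg (m - r) (E - T) G"
    using sum_subsets_of_card_supset[of E T m G] assms(1,2) T GT rn
    by (simp add: avg_def q_def incl_prob_def cET)
  \<comment> \<open>The factor \<open>a\<close> lets one inequality serve both tails. For
    \<open>a \<ge> 0\<close> the product \<open>G\<close> is monotone and conditioning lowers its
    average; for negative \<open>a\<close> it is antimonotone, its factors being nonnegative by
    \<open>- 1 \<le> a\<close>, and multiplying by \<open>a\<close> reverses the inequality
    again.\<close>
  have le: "a * avg (m - r) (E - T) G \<le> a * avg m E G"
  proof (cases "a \<ge> 0")
    case True
    have "mono G" unfolding G_def using True
      by (intro monoI prod_mono) (auto simp: of_bool_def)
    then have "avg (m - r) (E - T) G \<le> avg (m - r + card T) (E - T \<union> T) G"
      using assms(1,3) T cET by (intro avg_mono_Un) auto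
    then show ?thesis using True T assms(2) by (simp add: mult_left_mono Un_absorb2)
  next
    case False
    have "antimono G" unfolding G_def using False assms(4)
      by (intro antimonoI prod_mono) (auto simp: of_bool_def)
    then have "avg (m - r + card T) (E - T \<union> T) G \<le> avg (m - r) (E - T) G"
      using assms(1,3) T cET by (intro avg_antimono_Un) auto
    then show ?thesis using False T assms(2) by (simp add: mult_left_mono_neg Un_absorb2)
  qed
  have q0: "0 \<le> q" by (simp add: q_def incl_prob_def)
  have q1: "q \<le> 1"
    using incl_prob_le_1[OF assms(2,3)] by (simp add: q_def)
  \<comment> \<open>Needed to multiply the induction hypothesis by this factor.\<close>
  have nn: "0 \<le> 1 + a * q"
    using mult_mono'[of "- a" 1 q 1] q0 q1 assms(4) by (cases "a \<ge> 0") auto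
  have "avg m E (\<lambda>S. \<Prod>T\<in>insert T F. 1 + a * of_bool (T \<subseteq> S)) = avg m E (\<lambda>S. G S + a * (of_bool (T \<subseteq> S) * G S))"
    using insert.hyps by (simp add: G_def algebra_simps)
  also have "\<dots> = avg m E G + a * ((\<Sum>S\<in>subsets_of_card m E. of_bool (T \<subseteq> S) * G S) / real (card E choose m))"
    unfolding avg_def by (simp add: sum.distrib sum_distrib_left add_divide_distrib)
  also have "\<dots> = avg m E G + q * (a * avg (m - r) (E - T) G)"
    by (simp add: cond)
  also have "\<dots> \<le> avg m E G + q * (a * avg m E G)"
    by (rule add_left_mono[OF mult_left_mono[OF le q0]])
  also have "\<dots> = (1 + a * q) * avg m E G" by (simp add: algebra_simps)
  also have "\<dots> \<le> (1 + a * q) * (1 + a * q) ^ card F"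
    using insert nn unfolding G_def q_def by (intro mult_left_mono) (auto simp: pairwise_insert)
  finally show ?case using insert.hyps by (simp add: q_def)
qed

section \<open>Exponential moments, the tail bound, and the colouring it takes as input\<close>

lemma avg_const: "finite E \<Longrightarrow> m \<le> card E \<Longrightarrow> avg m E (\<lambda>_. c) = c"
  by (simp add: avg_def n_subsets)

lemma avg_mono:
  assumes "\<And>S. S \<subseteq> E \<Longrightarrow> G S \<le> H S"
  shows "avg m E G \<le> avg m E H"
  unfolding avg_def using assms by (intro divide_right_mono sum_mono) auto

lemma avg_add: "avg m E (\<lambda>S. G S + H S) = avg m E G + avg m E H"
  by (simp add: avg_def sum.distrib add_divide_distrib)

lemma avg_cmult: "avg m E (\<lambda>S. c * G S) = c * avg m E G"
  by (simp add: avg_def sum_distrib_left)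

lemma avg_sum: "avg m E (\<lambda>S. \<Sum>i\<in>I. G i S) = (\<Sum>i\<in>I. avg m E (G i))"
  unfolding avg_def by (subst sum.swap) (simp add: sum_divide_distrib)

text \<open>Supplies the variance term of the exponential moments for exponents of either sign. For
  \<open>x = - y\<close> with \<open>y > 0\<close> it follows from \<open>exp y \<ge> 1 + y\<close>
  and \<open>(1 - y + y\<^sup>2) * (1 + y) = 1 + y ^ 3\<close>.\<close>

lemma exp_le_quadratic:
  fixes x :: real
  assumes "\<bar>x\<bar> \<le> 1"
  shows "exp x \<le> 1 + x + x\<^sup>2"
proof (cases "x \<ge> 0")
  case True
  then show ?thesis using exp_bound[of x] assms by simp
next
  case False
  define y where "y = - x"
  have y: "0 < y" using False by (simp add: y_def)
  have "exp x = 1 / exp y" by (simp add: y_def exp_minus divide_inverse)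
  also have "\<dots> \<le> 1 / (1 + y)"
    using exp_ge_add_one_self[of y] y by (intro divide_left_mono) auto
  also have "\<dots> \<le> 1 - y + y\<^sup>2"
  proof -
    have "(1 - y + y\<^sup>2) * (1 + y) = 1 + y ^ 3" by (simp add: algebra_simps power2_eq_square power3_eq_cube)
    then have "1 \<le> (1 - y + y\<^sup>2) * (1 + y)" using y by simp
    then show ?thesis using y by (simp add: pos_divide_le_eq)
  qed
  finally show ?thesis by (simp add: y_def)
qed

text \<open>The exponential of the count is a product of factors
  \<open>1 + (exp l - 1) * of_bool (T \<subseteq> S)\<close>, so \<open>avg_prod_le\<close> with
  \<open>a = exp l - 1\<close> gives the binomial bound. Each factor is then at most
  \<open>exp ((l + l\<^sup>2) * q)\<close>, and centring cancels the linear term.\<close>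

lemma avg_exp_disjoint_le:
  fixes F :: "'a set set"
  assumes "finite E" "r \<le> m" "m \<le> card E" "finite F" "disjoint F"
    and "\<And>T. T \<in> F \<Longrightarrow> T \<subseteq> E \<and> card T = r" and "\<bar>l\<bar> \<le> 1"
  defines "q \<equiv> incl_prob r m (card E)"
  shows "avg m E (\<lambda>S. exp (l * (real (card {T \<in> F. T \<subseteq> S}) - q * real (card F)))) \<le>
         exp (q * real (card F) * l\<^sup>2)"
proof -
  have q0: "0 \<le> q" by (simp add: q_def incl_prob_nonneg)
  have prod: "exp (l * real (card {T \<in> F. T \<subseteq> S})) = (\<Prod>T\<in>F. 1 + (exp l - 1) * of_bool (T \<subseteq> S))" for S
  proof -
    have "real (card {T \<in> F. T \<subseteq> S}) = (\<Sum>T\<in>F. of_bool (T \<subseteq> S))"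
      using assms(4) by (simp add: of_bool_def sum.If_cases Int_def)
    then have "exp (l * real (card {T \<in> F. T \<subseteq> S})) = (\<Prod>T\<in>F. exp (l * of_bool (T \<subseteq> S)))"
      using assms(4) by (simp only: sum_distrib_left exp_sum)
    also have "\<dots> = (\<Prod>T\<in>F. 1 + (exp l - 1) * of_bool (T \<subseteq> S))"
      by (intro prod.cong) auto
    finally show ?thesis .
  qed
  have "avg m E (\<lambda>S. exp (l * real (card {T \<in> F. T \<subseteq> S}))) \<le> (1 + (exp l - 1) * q) ^ card F"
    unfolding prod q_def using assms by (intro avg_prod_le) auto
  also have "\<dots> \<le> exp ((l + l\<^sup>2) * q) ^ card F"
  proof (intro power_mono)
    have "(exp l - 1) * q \<le> (l + l\<^sup>2) * q"
      using exp_le_quadratic[OF assms(7)] q0 by (intro mult_right_mono) auto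
    then show "1 + (exp l - 1) * q \<le> exp ((l + l\<^sup>2) * q)"
      using exp_ge_add_one_self[of "(l + l\<^sup>2) * q"] by linarith
    have "0 \<le> 1 - q" using incl_prob_le_1[OF assms(2,3)] by (simp add: q_def)
    moreover have "1 + (exp l - 1) * q = (1 - q) + exp l * q" by (simp add: algebra_simps)
    ultimately show "0 \<le> 1 + (exp l - 1) * q" using q0 by (metis add_nonneg_nonneg exp_ge_zero mult_nonneg_nonneg)
  qed
  also have "\<dots> = exp (real (card F) * ((l + l\<^sup>2) * q))"
    by (simp add: exp_of_nat_mult)
  finally have le: "avg m E (\<lambda>S. exp (l * real (card {T \<in> F. T \<subseteq> S}))) \<le> exp (real (card F) * ((l + l\<^sup>2) * q))" .
  have "avg m E (\<lambda>S. exp (l * (real (card {T \<in> F. T \<subseteq> S}) - q * real (card F)))) =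
      avg m E (\<lambda>S. exp (- l * q * real (card F)) * exp (l * real (card {T \<in> F. T \<subseteq> S})))"
    by (simp add: mult_exp_exp algebra_simps)
  also have "\<dots> \<le> exp (- l * q * real (card F)) * exp (real (card F) * ((l + l\<^sup>2) * q))"
    unfolding avg_cmult by (intro mult_left_mono le) simp
  also have "\<dots> = exp (q * real (card F) * l\<^sup>2)"
    by (simp add: mult_exp_exp algebra_simps)
  finally show ?thesis .
qed

text \<open>Jensen's inequality with weights \<open>(n\<^sub>k / D + 1 / K) / 2\<close> makes up for the colour classes being of
  unequal sizes \<open>n\<^sub>k\<close>: each weight is at least half the proportion of its class and at least \<open>1 / (2 K)\<close>.\<close>

lemma avg_exp_coloured_le:
  fixes F :: "'a set set" and c :: "'a set \<Rightarrow> nat"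
  assumes "finite E" "r \<le> m" "m \<le> card E" "finite F"
    and sub: "\<And>T. T \<in> F \<Longrightarrow> T \<subseteq> E \<and> card T = r"
    and K: "\<And>T. T \<in> F \<Longrightarrow> c T < K"
    and disj: "\<And>T T'. T \<in> F \<Longrightarrow> T' \<in> F \<Longrightarrow> T \<noteq> T' \<Longrightarrow> c T = c T' \<Longrightarrow> T \<inter> T' = {}"
    and l: "\<bar>l\<bar> * (2 * real K) \<le> 1"
  defines "q \<equiv> incl_prob r m (card E)"
  shows "avg m E (\<lambda>S. exp (l * (real (card {T \<in> F. T \<subseteq> S}) - q * real (card F)))) \<le>
         exp (4 * q * real (card F) * real K * l\<^sup>2)"
proof (cases "F = {}")
  case True
  then show ?thesis using assms by (simp add: avg_const)
next
  case False
  define D where "D = real (card F)"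
  have D: "D > 0" using False assms(4) by (simp add: D_def card_gt_0_iff)
  have K0: "real K > 0" using False K by fastforce
  have q0: "0 \<le> q" by (simp add: q_def incl_prob_nonneg)
  define Fk where "Fk k = {T \<in> F. c T = k}" for k
  define n where "n k = real (card (Fk k))" for k
  define w where "w k = (n k / D + 1 / real K) / 2" for k
  have finFk: "finite (Fk k)" for k using assms(4) by (simp add: Fk_def)
  have count: "real (card {T \<in> F. P T}) = (\<Sum>k<K. real (card {T \<in> Fk k. P T}))" for P
  proof -
    have "{T \<in> F. P T} = (\<Union>k<K. {T \<in> Fk k. P T})" using K by (auto simp: Fk_def)
    then have "card {T \<in> F. P T} = (\<Sum>k<K. card {T \<in> Fk k. P T})"
      using assms(4) by (simp only:) (intro card_UN_disjoint, auto simp: Fk_def)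
    then show ?thesis by simp
  qed
  have nsum: "(\<Sum>k<K. n k) = D" using count[of "\<lambda>_. True"] by (simp add: n_def D_def)
  have n0: "n k \<ge> 0" for k by (simp add: n_def)
  have w0: "w k > 0" for k using n0[of k] D K0 by (simp add: w_def add_nonneg_pos)
  have wK: "1 / w k \<le> 2 * real K" for k
  proof -
    have "1 / (2 * real K) \<le> w k" using n0[of k] D K0 by (simp add: w_def field_simps)
    then have "1 / w k \<le> 1 / (1 / (2 * real K))" using K0 w0[of k] by (intro divide_left_mono) auto
    then show ?thesis by simp
  qed
  have wn: "n k / w k \<le> 2 * D" for k
  proof -
    have "n k / (2 * D) \<le> w k" using n0[of k] D K0 by (simp add: w_def field_simps)
    then show ?thesis using w0[of k] D by (simp add: field_simps)
  qed
  have wsum: "(\<Sum>k<K. w k) = 1"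
  proof -
    have "(\<Sum>k<K. w k) = ((\<Sum>k<K. n k) / D + (\<Sum>k<K. 1 / real K)) / 2"
      by (simp add: w_def sum_divide_distrib[symmetric] sum.distrib)
    then show ?thesis using nsum D K0 by simp
  qed
  \<comment> \<open>Dividing \<open>l\<close> by \<open>w k\<close> compensates the weight: the
    weighted sum of the class exponents is the exponent of the whole family, so convexity of
    \<open>exp\<close> applies.\<close>
  define Z where "Z k S = exp (l / w k * (real (card {T \<in> Fk k. T \<subseteq> S}) - q * n k))" for k S
  have jensen: "exp (l * (real (card {T \<in> F. T \<subseteq> S}) - q * real (card F))) \<le> (\<Sum>k<K. w k * Z k S)" for S
  proof -
    have "l * (real (card {T \<in> F. T \<subseteq> S}) - q * real (card F))
        = l * ((\<Sum>k<K. real (card {T \<in> Fk k. T \<subseteq> S})) - q * (\<Sum>k<K. n k))"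
      by (simp add: count nsum D_def)
    also have "\<dots> = (\<Sum>k<K. w k *\<^sub>R (l / w k * (real (card {T \<in> Fk k. T \<subseteq> S}) - q * n k)))"
      using w0 by (simp add: sum_distrib_left sum_subtractf right_diff_distrib less_imp_neq[symmetric])
    finally have eq: "l * (real (card {T \<in> F. T \<subseteq> S}) - q * real (card F)) =
        (\<Sum>k<K. w k *\<^sub>R (l / w k * (real (card {T \<in> Fk k. T \<subseteq> S}) - q * n k)))" .
    show ?thesis unfolding eq Z_def
      using wsum w0 K0 by (intro convex_on_sum[where C = UNIV] exp_convex) (auto simp: less_imp_le)
  qed
  have Zle: "avg m E (Z k) \<le> exp (4 * q * D * real K * l\<^sup>2)" for k
  proof -
    \<comment> \<open>Here the bound on \<open>l\<close> enters: since
      \<open>1 / w k \<le> 2 * real K\<close>, the rescaled exponent stays in the range of the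
      quadratic estimate.\<close>
    have lw: "\<bar>l / w k\<bar> \<le> 1"
    proof -
      have "\<bar>l / w k\<bar> = \<bar>l\<bar> * (1 / w k)" using w0[of k] by (simp add: abs_divide)
      also have "\<dots> \<le> \<bar>l\<bar> * (2 * real K)" by (intro mult_left_mono wK) auto
      finally show ?thesis using l by linarith
    qed
    have "disjoint (Fk k)" using disj by (auto simp: pairwise_def disjnt_def Fk_def)
    then have "avg m E (Z k) \<le> exp (q * n k * (l / w k)\<^sup>2)"
      unfolding Z_def n_def q_def using assms finFk lw sub
      by (intro avg_exp_disjoint_le) (auto simp: Fk_def)
    \<comment> \<open>One factor \<open>1 / w k\<close> is charged to the class size, costing
      \<open>2 * D\<close>, the other to the number of classes, costing \<open>2 * real K\<close>.
      This makes the bound the same for all classes.\<close>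
    also have "q * n k * (l / w k)\<^sup>2 = q * l\<^sup>2 * (n k / w k * (1 / w k))"
      by (simp add: power2_eq_square)
    also have "\<dots> \<le> q * l\<^sup>2 * (2 * D * (2 * real K))"
      using wn wK q0 w0 D by (intro mult_left_mono mult_mono) (auto simp: less_imp_le)
    also have "\<dots> = 4 * q * D * real K * l\<^sup>2" by simp
    finally show ?thesis by simp
  qed
  have "avg m E (\<lambda>S. exp (l * (real (card {T \<in> F. T \<subseteq> S}) - q * real (card F)))) \<le>
      avg m E (\<lambda>S. \<Sum>k<K. w k * Z k S)"
    by (intro avg_mono jensen)
  also have "\<dots> = (\<Sum>k<K. w k * avg m E (Z k))" by (simp add: avg_sum avg_cmult)
  also have "\<dots> \<le> (\<Sum>k<K. w k * exp (4 * q * D * real K * l\<^sup>2))"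
    using Zle w0 by (intro sum_mono mult_left_mono) (auto simp: less_imp_le)
  also have "\<dots> = exp (4 * q * D * real K * l\<^sup>2)"
    by (simp add: sum_distrib_right[symmetric] wsum)
  finally show ?thesis by (simp add: D_def)
qed

text \<open>Chernoff's method for both tails, with the moment bound of
  \<open>avg_exp_coloured_le\<close> at \<open>l\<close> and \<open>- l\<close>.\<close>

lemma avg_deviation_le:
  fixes F :: "'a set set" and c :: "'a set \<Rightarrow> nat"
  assumes "finite E" "r \<le> m" "m \<le> card E" "finite F"
    and "\<And>T. T \<in> F \<Longrightarrow> T \<subseteq> E \<and> card T = r"
    and "\<And>T. T \<in> F \<Longrightarrow> c T < K"
    and "\<And>T T'. T \<in> F \<Longrightarrow> T' \<in> F \<Longrightarrow> T \<noteq> T' \<Longrightarrow> c T = c T' \<Longrightarrow> T \<inter> T' = {}"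
    and e: "0 < e" "e \<le> 1" and K: "K > 0"
  defines "\<mu> \<equiv> incl_prob r m (card E) * real (card F)"
  shows "avg m E (\<lambda>S. of_bool (e * \<mu> \<le> \<bar>real (card {T \<in> F. T \<subseteq> S}) - \<mu>\<bar>)) \<le>
         2 * exp (- (e\<^sup>2 * \<mu> / (16 * real K)))"
proof -
  \<comment> \<open>The minimiser of the final exponent
    \<open>4 * \<mu> * real K * l\<^sup>2 - l * e * \<mu>\<close>; by \<open>e \<le> 1\<close> it is
    small enough for the moment bound.\<close>
  define l where "l = e / (8 * real K)"
  define X where "X S = real (card {T \<in> F. T \<subseteq> S}) - \<mu>" for S
  define B where "B = exp (- (l * e * \<mu>))"
  have l0: "l > 0" and lK: "l * (2 * real K) \<le> 1" using e K by (auto simp: l_def field_simps)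
  have mgf: "avg m E (\<lambda>S. exp (s * X S)) \<le> exp (4 * \<mu> * real K * l\<^sup>2)" if "s = l \<or> s = - l" for s
  proof -
    have "\<bar>s\<bar> * (2 * real K) \<le> 1" "s\<^sup>2 = l\<^sup>2" using lK l0 that by auto
    then show ?thesis
      using avg_exp_coloured_le[of E r m F c K s] assms(1-7) by (simp add: X_def \<mu>_def mult.assoc)
  qed
  have "avg m E (\<lambda>S. of_bool (e * \<mu> \<le> \<bar>X S\<bar>)) \<le> avg m E (\<lambda>S. B * exp (l * X S) + B * exp (- l * X S))"
  proof (rule avg_mono)
    fix S
    show "of_bool (e * \<mu> \<le> \<bar>X S\<bar>) \<le> B * exp (l * X S) + B * exp (- l * X S)"
    proof (cases "e * \<mu> \<le> \<bar>X S\<bar>")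
      case True
      then have "l * (e * \<mu>) \<le> l * X S \<or> l * (e * \<mu>) \<le> l * - X S"
        using l0 by (auto simp only: abs_if mult_le_cancel_left_pos split: if_splits)
      then have "1 \<le> B * exp (l * X S) \<or> 1 \<le> B * exp (- l * X S)"
        by (auto simp: B_def mult_exp_exp algebra_simps)
      moreover have "0 \<le> B * exp (l * X S)" "0 \<le> B * exp (- l * X S)" by (auto simp: B_def)
      ultimately show ?thesis using True by (simp only: of_bool_eq) linarith
    qed (simp add: B_def)
  qed
  also have "\<dots> = B * avg m E (\<lambda>S. exp (l * X S)) + B * avg m E (\<lambda>S. exp (- l * X S))"
    by (simp only: avg_add avg_cmult)
  also have "\<dots> \<le> B * exp (4 * \<mu> * real K * l\<^sup>2) + B * exp (4 * \<mu> * real K * l\<^sup>2)"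
    by (intro add_mono mult_left_mono mgf) (auto simp: B_def)
  also have "\<dots> = 2 * exp (4 * \<mu> * real K * l\<^sup>2 - l * e * \<mu>)"
    by (simp add: B_def mult_exp_exp)
  also have "4 * \<mu> * real K * l\<^sup>2 - l * e * \<mu> = - (e\<^sup>2 * \<mu> / (16 * real K))"
    using K by (simp add: l_def field_simps power2_eq_square)
  finally show ?thesis by (simp add: X_def)
qed

text \<open>Vertices are coloured one at a time: fewer than \<open>K\<close> colours occur among the
  neighbours of the new vertex, so one is free. \<open>R\<close> may relate a vertex to itself; the
  degree bound then counts that vertex, while the colouring condition exempts it.\<close>

lemma greedy_colouring:
  fixes R :: "'a \<Rightarrow> 'a \<Rightarrow> bool"
  assumes "finite V" "\<And>v w. R v w \<Longrightarrow> R w v" "\<And>v. v \<in> V \<Longrightarrow> card {w \<in> V. R v w} < K"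
  obtains c :: "'a \<Rightarrow> nat" where "\<And>v. v \<in> V \<Longrightarrow> c v < K"
    "\<And>v w. v \<in> V \<Longrightarrow> w \<in> V \<Longrightarrow> v \<noteq> w \<Longrightarrow> R v w \<Longrightarrow> c v \<noteq> c w"
proof -
  have "\<exists>c :: 'a \<Rightarrow> nat. (\<forall>v\<in>V. c v < K) \<and> (\<forall>v\<in>V. \<forall>w\<in>V. v \<noteq> w \<longrightarrow> R v w \<longrightarrow> c v \<noteq> c w)"
    using assms(1,3)
  proof (induction V rule: finite_induct)
    case (insert x V)
    have small: "card {w \<in> V. R v w} < K" if "v \<in> V" for v
      using insert.prems[of v] that insert.hyps(1)
        card_mono[of "{w \<in> insert x V. R v w}" "{w \<in> V. R v w}"] by fastforce
    have "\<exists>c :: 'a \<Rightarrow> nat. (\<forall>v\<in>V. c v < K) \<and> (\<forall>v\<in>V. \<forall>w\<in>V. v \<noteq> w \<longrightarrow> R v w \<longrightarrow> c v \<noteq> c w)"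
      by (rule insert.IH) (rule small)
    then obtain c :: "'a \<Rightarrow> nat"
      where c: "\<forall>v\<in>V. c v < K" "\<forall>v\<in>V. \<forall>w\<in>V. v \<noteq> w \<longrightarrow> R v w \<longrightarrow> c v \<noteq> c w"
      by (elim exE conjE)
    have "card (c ` {w \<in> V. R x w}) \<le> card {w \<in> V. R x w}"
      using insert.hyps(1) by (intro card_image_le) auto
    also have "\<dots> \<le> card {w \<in> insert x V. R x w}" using insert.hyps(1) by (intro card_mono) auto
    also have "\<dots> < card {..<K}" using insert.prems[of x] by simp
    finally have "\<not> {..<K} \<subseteq> c ` {w \<in> V. R x w}"
      using card_mono[of "c ` {w \<in> V. R x w}" "{..<K}"] insert.hyps(1) by auto
    then obtain k where k: "k < K" "k \<notin> c ` {w \<in> V. R x w}" by auto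
    have "(\<forall>v\<in>insert x V. (c(x := k)) v < K) \<and>
      (\<forall>v\<in>insert x V. \<forall>w\<in>insert x V. v \<noteq> w \<longrightarrow> R v w \<longrightarrow> (c(x := k)) v \<noteq> (c(x := k)) w)"
      using c k insert.hyps(2) by (auto simp: image_iff) (metis assms(2))
    then show ?case by (intro exI[of _ "c(x := k)"])
  qed simp
  then obtain c :: "'a \<Rightarrow> nat" where "\<forall>v\<in>V. c v < K" "\<forall>v\<in>V. \<forall>w\<in>V. v \<noteq> w \<longrightarrow> R v w \<longrightarrow> c v \<noteq> c w"
    by (elim exE conjE)
  then show ?thesis by (intro that[of c]) simp_all
qed

section \<open>Uniformity of reservoir sampling\<close>

lemma pmf_bind_pmf_of_set':
  assumes "finite A" "A \<noteq> {}"
  shows "pmf (pmf_of_set A \<bind> f) x = (\<Sum>a\<in>A. pmf (f a) x) / real (card A)"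
  using assms by (simp add: pmf_bind integral_pmf_of_set)

text \<open>Every \<open>m\<close>-subset \<open>A\<close> arises from exactly
  \<open>card E - m\<close> pairs \<open>(S, f)\<close>, namely those with
  \<open>S = insert f A\<close> and \<open>f\<close> outside \<open>A\<close>. Hence all
  \<open>m\<close>-subsets get the same mass, which the absorption identity evaluates.\<close>

lemma remove_uniform_element:
  assumes "finite E" "Suc m \<le> card E"
  shows "pmf_of_set (subsets_of_card (Suc m) E) \<bind> (\<lambda>S. map_pmf (\<lambda>f. S - {f}) (pmf_of_set S)) =
         pmf_of_set (subsets_of_card m E)"
proof (rule pmf_eqI)
  fix A
  let ?U = "\<lambda>m. subsets_of_card m E"
  have fin: "finite (?U k)" for k using assms(1) by simp
  have ne: "?U k \<noteq> {}" if "k \<le> card E" for k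
    using obtain_subset_with_card_n[OF that] by blast
  have finS: "finite S" if "S \<subseteq> E" for S using that assms(1) finite_subset by blast
  have "pmf (pmf_of_set (?U (Suc m)) \<bind> (\<lambda>S. map_pmf (\<lambda>f. S - {f}) (pmf_of_set S))) A
      = (\<Sum>S\<in>?U (Suc m). pmf (map_pmf (\<lambda>f. S - {f}) (pmf_of_set S)) A) / real (card E choose Suc m)"
    using fin ne[OF assms(2)] assms(1) by (simp add: pmf_bind_pmf_of_set' n_subsets)
  also have "(\<Sum>S\<in>?U (Suc m). pmf (map_pmf (\<lambda>f. S - {f}) (pmf_of_set S)) A)
      = (\<Sum>S\<in>?U (Suc m). (\<Sum>f\<in>S. of_bool (S - {f} = A)) / real (Suc m))"
  proof (intro sum.cong refl)
    fix S assume S: "S \<in> ?U (Suc m)"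
    then have "S \<noteq> {}" "finite S" using finS by auto
    then show "pmf (map_pmf (\<lambda>f. S - {f}) (pmf_of_set S)) A = (\<Sum>f\<in>S. of_bool (S - {f} = A)) / real (Suc m)"
      using S by (simp add: map_pmf_def pmf_bind_pmf_of_set' of_bool_def indicator_def eq_commute)
  qed
  also have "\<dots> = (\<Sum>(S, f)\<in>(SIGMA S:?U (Suc m). S). of_bool (S - {f} = A)) / real (Suc m)"
    unfolding sum_divide_distrib[symmetric] using fin finS by (subst sum.Sigma) auto
  also have "(\<Sum>(S, f)\<in>(SIGMA S:?U (Suc m). S). of_bool (S - {f} = A)) =
      (\<Sum>(S, f)\<in>(SIGMA S:?U m. E - S). of_bool (S = A) :: real)"
    by (rule sum.reindex_bij_witness[where i = "\<lambda>(S, y). (insert y S, y)" and j = "\<lambda>(S, y). (S - {y}, y)"])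
       (auto simp: finS card_insert_if)
  also have "\<dots> = (\<Sum>S\<in>?U m. \<Sum>f\<in>E - S. of_bool (S = A))"
    using fin assms(1) by (subst sum.Sigma) auto
  also have "\<dots> = (\<Sum>S\<in>?U m. if S = A then real (card E - m) else 0)"
    using finS by (intro sum.cong) (auto simp: card_Diff_subset)
  also have "\<dots> = of_bool (A \<in> ?U m) * real (card E - m)"
    using fin by (simp add: sum.delta')
  also have "of_bool (A \<in> ?U m) * real (card E - m) / real (Suc m) / real (card E choose Suc m)
      = of_bool (A \<in> ?U m) / real (card E choose m)"
  proof -
    have "Suc m * (card E choose Suc m) = (card E - m) * (card E choose m)"
      by (simp only: binomial_absorption binomial_absorb_comp)
    then have "real (Suc m) * real (card E choose Suc m) = real (card E - m) * real (card E choose m)"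
      by (simp only: of_nat_mult[symmetric])
    then show ?thesis using assms(2) by (simp add: divide_divide_eq_left del: of_nat_Suc)
  qed
  also have "\<dots> = pmf (pmf_of_set (?U m)) A"
    using fin ne[of m] assms by (simp add: n_subsets of_bool_def indicator_def)
  finally show "pmf (pmf_of_set (?U (Suc m)) \<bind> (\<lambda>S. map_pmf (\<lambda>f. S - {f}) (pmf_of_set S))) A =
    pmf (pmf_of_set (?U m)) A" .
qed

text \<open>With \<open>n = card E\<close> and acceptance probability
  \<open>p = M / (n + 1)\<close>, an \<open>M\<close>-subset containing \<open>e\<close> gets mass
  \<open>p / (n choose (M - 1))\<close> and any other gets \<open>(1 - p) / (n choose M)\<close>.
  Both equal \<open>1 / (n + 1 choose M)\<close>.\<close>

lemma reservoir_step_uniform: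
  assumes "finite E" "0 < M" "M \<le> card E" "e \<notin> E"
  shows "pmf_of_set (subsets_of_card M E) \<bind> (\<lambda>S. bernoulli_pmf (real M / real (Suc (card E))) \<bind>
           (\<lambda>b. if b then map_pmf (\<lambda>f. insert e (S - {f})) (pmf_of_set S) else return_pmf S)) =
         pmf_of_set (subsets_of_card M (insert e E))" (is "?L = _")
proof -
  obtain m where m: "M = Suc m" using assms(2) by (cases M) auto
  let ?U = "\<lambda>m. subsets_of_card m E" and ?n = "card E"
  define p where "p = real M / real (Suc ?n)"
  have p: "0 \<le> p" "p \<le> 1" using assms(3) by (auto simp: p_def)
  have fin: "finite (subsets_of_card k F)" if "finite F" for k and F :: "'a set" using that by simp
  have ne: "subsets_of_card k F \<noteq> {}" if "k \<le> card F" for k and F :: "'a set"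
    using obtain_subset_with_card_n[OF that] by blast
  \<comment> \<open>The coin does not depend on the sample, so it may be tossed first; each branch
    then acts on a uniform law.\<close>
  have "?L = bernoulli_pmf p \<bind> (\<lambda>b. pmf_of_set (?U M) \<bind>
           (\<lambda>S. if b then map_pmf (\<lambda>f. insert e (S - {f})) (pmf_of_set S) else return_pmf S))"
    unfolding p_def by (rule bind_commute_pmf)
  also have "\<dots> = bernoulli_pmf p \<bind> (\<lambda>b. if b then map_pmf (insert e) (pmf_of_set (?U m)) else pmf_of_set (?U M))"
  proof (intro bind_pmf_cong refl)
    fix b
    have "pmf_of_set (?U M) \<bind> (\<lambda>S. map_pmf (\<lambda>f. insert e (S - {f})) (pmf_of_set S)) =
        map_pmf (insert e) (pmf_of_set (?U M) \<bind> (\<lambda>S. map_pmf (\<lambda>f. S - {f}) (pmf_of_set S)))"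
      by (simp add: map_bind_pmf pmf.map_comp o_def)
    then show "pmf_of_set (?U M) \<bind> (\<lambda>S. if b then map_pmf (\<lambda>f. insert e (S - {f})) (pmf_of_set S) else return_pmf S)
        = (if b then map_pmf (insert e) (pmf_of_set (?U m)) else pmf_of_set (?U M))"
      using remove_uniform_element[of E m] assms m by (auto simp: bind_return_pmf')
  qed
  also have "\<dots> = pmf_of_set (subsets_of_card M (insert e E))"
  proof (rule pmf_eqI)
    fix A
    have inj: "inj_on (insert e) (?U m)" using assms(4) by (auto simp: inj_on_def)
    have ins: "map_pmf (insert e) (pmf_of_set (?U m)) = pmf_of_set (insert e ` ?U m)"
      using inj ne[of m E] assms(1,3) m by (intro map_pmf_of_set_inj fin) auto
    have card_ins: "card (insert e ` ?U m) = ?n choose m"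
      using inj assms(1) by (simp add: card_image n_subsets)
    have "pmf (bernoulli_pmf p \<bind> (\<lambda>b. if b then map_pmf (insert e) (pmf_of_set (?U m)) else pmf_of_set (?U M))) A
       = p * (of_bool (A \<in> insert e ` ?U m) / real (?n choose m)) + (1 - p) * (of_bool (A \<in> ?U M) / real (?n choose M))"
      using p fin[OF assms(1)] ne[of m E] ne[of M E] assms m
      by (simp add: pmf_bind ins card_ins n_subsets of_bool_def indicator_def)
    moreover have "pmf (pmf_of_set (subsets_of_card M (insert e E))) A =
        of_bool (A \<in> subsets_of_card M (insert e E)) / real (Suc ?n choose M)"
      using fin[of "insert e E" M] ne[of M "insert e E"] assms
        n_subsets[of "insert e E" M]
      by (simp add: of_bool_def indicator_def)
    moreover have "A \<in> subsets_of_card M (insert e E) \<longleftrightarrow> (if e \<in> A then A \<in> insert e ` ?U m else A \<in> ?U M)"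
    proof (cases "e \<in> A")
      case True
      have "A \<in> insert e ` ?U m" if A: "A \<subseteq> insert e E" "card A = M"
      proof -
        have "finite A" using A(1) assms(1) finite_subset by blast
        then have "A = insert e (A - {e})" "A - {e} \<in> ?U m" using True A m by auto
        then show ?thesis by blast
      qed
      moreover have "card (insert e B) = M" if "B \<in> ?U m" for B
      proof -
        have "finite B" "e \<notin> B" using that assms finite_subset by blast+
        then show ?thesis using that m by simp
      qed
      ultimately show ?thesis using True by auto
    qed auto
    moreover have "A \<notin> insert e ` ?U m" if "e \<notin> A" using that by auto
    moreover have "A \<notin> ?U M" if "e \<in> A" using that assms(4) by auto
    moreover have "p / real (?n choose m) = 1 / real (Suc ?n choose M)"
    proof -
      have "Suc m * (Suc ?n choose Suc m) = Suc ?n * (?n choose m)"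
        using Suc_times_binomial_eq[of ?n m] by (simp only: mult.commute)
      then have "real M * real (Suc ?n choose M) = real (Suc ?n) * real (?n choose m)"
        unfolding m by (simp only: of_nat_mult[symmetric])
      moreover have "real (Suc ?n choose M) > 0" "real (?n choose m) > 0" using assms m
        by (simp_all del: binomial_Suc_Suc)
      ultimately show ?thesis by (simp add: p_def field_simps del: of_nat_Suc)
    qed
    moreover have "(1 - p) / real (?n choose M) = 1 / real (Suc ?n choose M)"
    proof -
      have "(Suc ?n - M) * (Suc ?n choose M) = Suc ?n * (?n choose M)"
        using binomial_absorb_comp[of "Suc ?n" M] by simp
      then have "real (Suc ?n - M) * real (Suc ?n choose M) = real (Suc ?n) * real (?n choose M)"
        by (simp only: of_nat_mult[symmetric])
      moreover have "real (Suc ?n choose M) > 0" "real (?n choose M) > 0" using assms m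
        by (simp_all del: binomial_Suc_Suc)
      moreover have "1 - p = real (Suc ?n - M) / real (Suc ?n)"
        using assms(3) by (simp add: p_def field_simps of_nat_diff)
      moreover have "a / b / x = 1 / y" if "a * y = b * x" "0 < b" "0 < x" "0 < y" for a b x y :: real
        using that by (simp add: field_simps)
      ultimately show ?thesis by (simp del: of_nat_Suc)
    qed
    ultimately show "pmf (bernoulli_pmf p \<bind> (\<lambda>b. if b then map_pmf (insert e) (pmf_of_set (?U m)) else pmf_of_set (?U M))) A
       = pmf (pmf_of_set (subsets_of_card M (insert e E))) A"
      by (auto simp: of_bool_def)
  qed
  finally show ?thesis .
qed

section \<open>Triangles in the sample and the law of the algorithm\<close>

lemma triangle_subset_card:
  assumes "T \<in> triangles E"
  shows "T \<subseteq> E" "card T = 3"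
proof -
  obtain u v w where "u \<noteq> v" "v \<noteq> w" "w \<noteq> u" "T = {{u, v}, {v, w}, {w, u}}" "T \<subseteq> E"
    using assms unfolding triangles_def by blast
  moreover from this have "{u, v} \<noteq> {v, w}" "{u, v} \<noteq> {w, u}" "{v, w} \<noteq> {w, u}"
    by (simp_all add: doubleton_eq_iff)
  ultimately show "T \<subseteq> E" "card T = 3" by simp_all
qed

lemma triangles_empty: "triangles {} = {}"
  unfolding triangles_def by simp

text \<open>Turns the triangle count of a sample into the count
  \<open>{T \<in> F. T \<subseteq> S}\<close> of the tail bound. Being a triangle splits into a
  shape, which does not depend on the graph, and an inclusion.\<close>

lemma triangles_subset: "S \<subseteq> E \<Longrightarrow> triangles S = {T \<in> triangles E. T \<subseteq> S}"
proof -
  have mem: "T \<in> triangles F \<longleftrightarrow> T \<in> triangles UNIV \<and> T \<subseteq> F" for T and F :: "'a set set"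
    unfolding triangles_def
    by (simp only: mem_Collect_eq subset_UNIV simp_thms conj_assoc[symmetric] ex_simps)
  show "S \<subseteq> E \<Longrightarrow> triangles S = {T \<in> triangles E. T \<subseteq> S}"
    using mem[of _ S] mem[of _ E] by blast
qed

lemma finite_triangles: "finite E \<Longrightarrow> finite (triangles E)"
  by (rule finite_subset[of _ "Pow E"]) (auto dest: triangle_subset_card)

lemma common_nb_doubleton:
  assumes "u \<noteq> v"
  shows "common_nb S {u, v} = card {c. {c, u} \<in> S \<and> {c, v} \<in> S}"
  unfolding common_nb_def using assms by (intro arg_cong[where f = card]) (auto simp: doubleton_eq_iff)

text \<open>The triangles through the new edge correspond to their apexes, the common neighbours of
  its ends. The second claim is needed because the algorithm counts after the insertion:
  \<open>e\<close> itself creates no common neighbour.\<close>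

lemma card_triangles_insert:
  assumes "finite S" "\<And>f. f \<in> S \<Longrightarrow> card f = 2" "e \<notin> S" "card e = 2"
  shows "card (triangles (insert e S)) = card (triangles S) + common_nb S e"
    and "common_nb (insert e S) e = common_nb S e"
proof -
  obtain u v where e: "e = {u, v}" "u \<noteq> v" using assms(4) by (auto simp: card_2_iff)
  let ?C = "{c. {c, u} \<in> S \<and> {c, v} \<in> S}"
  \<comment> \<open>An apex equal to an end of \<open>e\<close> would need a singleton as an
    edge.\<close>
  have nuv: "c \<noteq> u \<and> c \<noteq> v" if "{c, u} \<in> insert e S" "{c, v} \<in> insert e S" for c
    using that assms(2,4) by (metis card_1_singleton_iff insertE insert_absorb2 numeral_eq_one_iff
        one_eq_numeral_iff semiring_norm(85) One_nat_def)
  have "{c. {c, u} \<in> insert e S \<and> {c, v} \<in> insert e S} = ?C"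
    using nuv e by (auto simp: doubleton_eq_iff)
  then show "common_nb (insert e S) e = common_nb S e"
    using e by (simp add: common_nb_doubleton)
  define g where "g c = {{u, v}, {v, c}, {c, u}}" for c
  have eq: "triangles (insert e S) = triangles S \<union> g ` ?C"
  proof
    show "triangles (insert e S) \<subseteq> triangles S \<union> g ` ?C"
    proof
      fix T assume T: "T \<in> triangles (insert e S)"
      show "T \<in> triangles S \<union> g ` ?C"
      proof (cases "e \<in> T")
        case True
        obtain x y z where xyz: "x \<noteq> y" "y \<noteq> z" "z \<noteq> x" "T = {{x, y}, {y, z}, {z, x}}" "T \<subseteq> insert e S"
          using T unfolding triangles_def by blast
        have "\<exists>c. c \<noteq> u \<and> c \<noteq> v \<and> T = g c"
          using True xyz e unfolding g_def
          by (auto simp: doubleton_eq_iff insert_commute)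
        then obtain c where c: "c \<noteq> u" "c \<noteq> v" "T = g c" by blast
        then have "{c, u} \<in> insert e S" "{c, v} \<in> insert e S"
          using xyz(5) by (auto simp: g_def insert_commute)
        then have "c \<in> ?C" using c e by (auto simp: doubleton_eq_iff)
        then show ?thesis using c by blast
      next
        case False
        then show ?thesis using T triangles_subset[of S "insert e S"] triangle_subset_card(1)[OF T] by auto
      qed
    qed
    show "triangles S \<union> g ` ?C \<subseteq> triangles (insert e S)"
    proof
      fix T assume "T \<in> triangles S \<union> g ` ?C"
      then show "T \<in> triangles (insert e S)"
      proof
        assume "T \<in> triangles S"
        then show ?thesis using triangles_subset[of S "insert e S"] by auto
      next
        assume "T \<in> g ` ?C"
        then obtain c where c: "c \<in> ?C" "T = g c" by blast
        then have "c \<noteq> u" "c \<noteq> v" using nuv by auto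
        moreover have "T \<subseteq> insert e S" using c e by (auto simp: g_def insert_commute)
        ultimately show ?thesis using c(2) e unfolding triangles_def g_def by blast
      qed
    qed
  qed
  \<comment> \<open>The edge \<open>{v, c}\<close> must be one of the three edges of
    \<open>g d\<close>; \<open>c \<noteq> u\<close> and \<open>d \<noteq> v\<close> leave only
    \<open>{v, d}\<close>.\<close>
  have inj: "inj_on g ?C"
  proof (rule inj_onI)
    fix c d assume cd: "c \<in> ?C" "d \<in> ?C" "g c = g d"
    then have "c \<noteq> u" "d \<noteq> v" using nuv by auto
    moreover have "{v, c} \<in> g d" unfolding cd(3)[symmetric] by (simp add: g_def)
    then have "{v, c} = {u, v} \<or> {v, c} = {v, d} \<or> {v, c} = {d, u}" by (simp add: g_def)
    ultimately show "c = d" using e(2) by (simp add: doubleton_eq_iff)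
  qed
  have disj: "triangles S \<inter> g ` ?C = {}"
    using assms(3) e triangle_subset_card(1)[of _ S] by (auto simp: g_def)
  have "finite (g ` ?C)"
    using eq finite_triangles[of "insert e S"] assms(1) by simp
  then show "card (triangles (insert e S)) = card (triangles S) + common_nb S e"
    unfolding eq using disj inj assms(1) e
    by (simp add: card_Un_disjoint finite_triangles card_image common_nb_doubleton)
qed

text \<open>The states that the algorithm can reach: the counter is a function of the sample, so
  only the law of the sample has to be followed.\<close>

definition with_count :: "'v set set \<Rightarrow> 'v set set \<times> int" where
  "with_count S = (S, int (card (triangles S)))"

lemma triest_base_snoc:
  "triest_base M (es @ [e]) = triest_base M es \<bind> triest_step M (Suc (length es)) e"
proof -
  have "[1..<Suc (length (es @ [e]))] = [1..<Suc (length es)] @ [Suc (length es)]" by simp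
  then show ?thesis
    unfolding triest_base_def by (simp only: zip_append length_upt diff_Suc_1 foldl_append) simp
qed

text \<open>By induction on the arrivals. Each insertion or removal changes the counter by the
  number of triangles through the edge, so the state keeps the form \<open>with_count S\<close>; the
  sample evolves by \<open>reservoir_step_uniform\<close>. Positivity of \<open>M\<close> keeps the
  sample nonempty when an edge is to be evicted.\<close>

lemma triest_base_eq_uniform:
  assumes "valid_stream es" "0 < M"
  shows "triest_base M es = map_pmf with_count
           (if length es \<le> M then return_pmf (set es) else pmf_of_set (subsets_of_card M (set es)))"
  using assms(1)
proof (induction es rule: rev_induct)
  case Nil
  show ?case by (simp add: triest_base_def with_count_def triangles_empty)
next
  case (snoc e es)
  let ?E = "set es" and ?t = "Suc (length es)"
  have valid: "valid_stream es" and e: "card e = 2" "e \<notin> ?E"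
    and cards: "\<And>f. f \<in> ?E \<Longrightarrow> card f = 2" and len: "card ?E = length es"
    using snoc.prems by (fastforce simp: valid_stream_def card_2_iff distinct_card)+
  have IH: "triest_base M es = map_pmf with_count
     (if length es \<le> M then return_pmf ?E else pmf_of_set (subsets_of_card M ?E))"
    by (rule snoc.IH[OF valid])
  show ?case
  proof (cases "?t \<le> M")
    case True
    then have "triest_base M (es @ [e]) = triest_step M ?t e (with_count ?E)"
      by (simp add: triest_base_snoc IH bind_return_pmf)
    also have "\<dots> = return_pmf (with_count (insert e ?E))"
      using True card_triangles_insert[OF _ cards e(2,1)] by (simp add: triest_step_def with_count_def)
    finally show ?thesis using True by simp
  next
    case False
    \<comment> \<open>At the first step beyond the capacity the previous sample is the full edge
      set, the only \<open>M\<close>-subset, so its point mass is already the uniform law.\<close>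
    have IH': "triest_base M es = map_pmf with_count (pmf_of_set (subsets_of_card M ?E))"
    proof (cases "length es \<le> M")
      case True
      then have "length es = M" using False by simp
      then have "subsets_of_card M ?E = {?E}"
        using len card_subset_eq[of ?E] by auto
      then show ?thesis using IH True by (simp add: pmf_of_set_singleton)
    qed (simp add: IH)
    have Mle: "M \<le> card ?E" using False len by simp
    have step: "triest_step M ?t e (with_count S) = map_pmf with_count (bernoulli_pmf (real M / real (Suc (card ?E))) \<bind>
           (\<lambda>b. if b then map_pmf (\<lambda>f. insert e (S - {f})) (pmf_of_set S) else return_pmf S))"
      if S: "S \<in> subsets_of_card M ?E" for S
    proof -
      have finS: "finite S" "S \<noteq> {}" using S assms(2) finite_subset[of S ?E] by auto
      \<comment> \<open>Both updates are measured against \<open>S - {f}\<close>: eviction subtracts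
        the triangles that \<open>f\<close> closes there, insertion adds those that \<open>e\<close>
        closes there.\<close>
      have replace: "pmf_of_set S \<bind> (\<lambda>f. return_pmf (insert e (S - {f}),
            int (card (triangles S)) - int (common_nb (S - {f}) f) + int (common_nb (insert e (S - {f})) e)))
          = map_pmf (\<lambda>f. with_count (insert e (S - {f}))) (pmf_of_set S)"
        unfolding map_pmf_def
      proof (intro bind_pmf_cong refl)
        fix f assume "f \<in> set_pmf (pmf_of_set S)"
        then have f: "f \<in> S" using finS by simp
        have "card (triangles (insert f (S - {f}))) = card (triangles (S - {f})) + common_nb (S - {f}) f"
          using f S cards finS by (intro card_triangles_insert) auto
        moreover have "card (triangles (insert e (S - {f}))) = card (triangles (S - {f})) + common_nb (S - {f}) e"
          "common_nb (insert e (S - {f})) e = common_nb (S - {f}) e"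
          using f S cards finS e by (auto intro!: card_triangles_insert)
        ultimately show "return_pmf (insert e (S - {f}),
            int (card (triangles S)) - int (common_nb (S - {f}) f) + int (common_nb (insert e (S - {f})) e)) =
            return_pmf (with_count (insert e (S - {f})))"
          using f by (simp add: with_count_def insert_absorb)
      qed
      show ?thesis
        using False unfolding triest_step_def
        by (auto simp: with_count_def[of S] Let_def replace map_bind_pmf len pmf.map_comp o_def if_distrib
            intro!: bind_pmf_cong)
    qed
    have ne: "subsets_of_card M ?E \<noteq> {}"
      using obtain_subset_with_card_n[OF Mle] by blast
    have "triest_base M (es @ [e]) = pmf_of_set (subsets_of_card M ?E) \<bind> (\<lambda>S. triest_step M ?t e (with_count S))"
      by (simp add: triest_base_snoc IH' bind_map_pmf)
    also have "\<dots> = map_pmf with_count (pmf_of_set (subsets_of_card M ?E) \<bind> (\<lambda>S. bernoulli_pmf (real M / real (Suc (card ?E))) \<bind>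
           (\<lambda>b. if b then map_pmf (\<lambda>f. insert e (S - {f})) (pmf_of_set S) else return_pmf S)))"
      unfolding map_bind_pmf[of with_count "pmf_of_set (subsets_of_card M ?E)"]
      using ne by (intro bind_pmf_cong refl step) simp
    also have "\<dots> = map_pmf with_count (pmf_of_set (subsets_of_card M (insert e ?E)))"
      using reservoir_step_uniform[of ?E M e] assms(2) Mle e(2) by simp
    finally show ?thesis using False by simp
  qed
qed

section \<open>Numerical estimates and the concentration theorem\<close>

lemma xi_ab_3:
  "M < t \<Longrightarrow> xi_ab M 3 t = real t * (real t - 1) * (real t - 2) / (real M * (real M - 1) * (real M - 2))"
  by (simp add: xi_ab_def numeral_3_eq_3 lessThan_Suc mult_ac)

text \<open>Three applications of the absorption identity for binomials. For \<open>m < n\<close>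
  the right-hand side is the reciprocal of \<open>xi_ab m 3 n\<close>, which makes the estimator
  unbiased.\<close>

lemma incl_prob_3:
  assumes "3 \<le> m" "m \<le> n"
  shows "incl_prob 3 m n = real m * (real m - 1) * (real m - 2) / (real n * (real n - 1) * (real n - 2))"
proof -
  obtain a b where ab: "m = a + 3" "n = b + 3"
    using assms by (metis add.commute le_Suc_ex le_trans)
  have absorb: "real (k + 1) * real (j + 1 choose (k + 1)) = real (j + 1) * real (j choose k)" for j k
    using Suc_times_binomial_eq[of j k] by (simp only: of_nat_mult[symmetric] Suc_eq_plus1 mult.commute)
  have 1: "real (a + 3) * real (b + 3 choose (a + 3)) = real (b + 3) * real (b + 2 choose (a + 2))"
    using absorb[of "a + 2" "b + 2"] by (simp add: eval_nat_numeral)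
  have 2: "real (a + 2) * real (b + 2 choose (a + 2)) = real (b + 2) * real (b + 1 choose (a + 1))"
    using absorb[of "a + 1" "b + 1"] by (simp add: eval_nat_numeral)
  have 3: "real (a + 1) * real (b + 1 choose (a + 1)) = real (b + 1) * real (b choose a)"
    by (rule absorb)
  have "real (a + 3) * real (a + 2) * real (a + 1) * real (b + 3 choose (a + 3))
      = real (b + 3) * real (b + 2) * real (b + 1) * real (b choose a)"
    using 1 2 3 by algebra
  moreover have "real (b + 3 choose (a + 3)) > 0" using assms ab by simp
  ultimately show ?thesis
    unfolding incl_prob_def ab by (simp add: frac_eq_eq add_ac mult_ac)
qed

text \<open>Extracts a constant from the logarithmic factor. For \<open>x > 16\<close> the logarithm
  is at least 1 and the factor at least \<open>3 / 2\<close>; for \<open>x \<le> 16\<close> the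
  claim follows from \<open>3 / 2 * 16 = 24\<close> and \<open>25 \<le> N\<close>.\<close>

lemma one_and_half_le:
  fixes x N :: real
  assumes "25 \<le> N" "x * (1 + 1/2 * (root 3 (ln x))\<^sup>2) \<le> N"
  shows "3 / 2 * x \<le> N"
proof (cases "x \<le> 16")
  case False
  then have "exp 1 \<le> x" using exp_le by linarith
  then have "1 \<le> ln x" using False by (simp add: ln_ge_iff)
  then have "1 \<le> (root 3 (ln x))\<^sup>2" by (intro one_le_power) simp
  then have "3 / 2 \<le> 1 + 1/2 * (root 3 (ln x))\<^sup>2" by simp
  then have "3 / 2 * x \<le> x * (1 + 1/2 * (root 3 (ln x))\<^sup>2)"
    using False by (subst mult.commute) (intro mult_left_mono, auto)
  then show ?thesis using assms(2) by linarith
qed (use assms in linarith)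

text \<open>A union bound over the three edges of \<open>T\<close>; the count includes
  \<open>T\<close> itself.\<close>

lemma card_triangles_meeting_le:
  assumes "finite E" "T \<in> triangles E"
  shows "card {T' \<in> triangles E. T \<inter> T' \<noteq> {}} \<le> 3 * max_tri_per_edge E"
proof -
  have T: "T \<subseteq> E" "card T = 3" "finite T"
    using triangle_subset_card[OF assms(2)] by (auto intro: card_ge_0_finite)
  have "card {T' \<in> triangles E. T \<inter> T' \<noteq> {}} \<le> card (\<Union>f\<in>T. {T' \<in> triangles E. f \<in> T'})"
    using assms(1) T(3) finite_triangles by (intro card_mono) auto
  also have "\<dots> \<le> (\<Sum>f\<in>T. card {T' \<in> triangles E. f \<in> T'})"
    by (intro card_UN_le T)
  also have "\<dots> \<le> (\<Sum>f\<in>T. max_tri_per_edge E)"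
    unfolding max_tri_per_edge_def using T(1) assms(1) by (intro sum_mono Max_ge) auto
  finally show ?thesis using T by simp
qed

theorem theorem4p5:
  fixes M :: nat and es :: "'v set list" and \<epsilon> \<delta> :: real
  assumes "M \<ge> 6"
    and "valid_stream es"
    and "card (triangles (set es)) > 0"
    and "0 < \<epsilon>" and "\<epsilon> < 1" and "0 < \<delta>" and "\<delta> < 1"
    and "M \<ge> Max {real (length es) *
                   root 3 (8 / \<epsilon>^2 * (3 * real (max_tri_per_edge (set es)) + 1)
                           / real (card (triangles (set es)))
                           * ln ((3 * real (max_tri_per_edge (set es)) + 1) * exp 1 / \<delta>))
                 * (1 + 1/2 * (root 3 (ln (real (length es) *
                   root 3 (8 / \<epsilon>^2 * (3 * real (max_tri_per_edge (set es)) + 1)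
                           / real (card (triangles (set es)))
                           * ln ((3 * real (max_tri_per_edge (set es)) + 1) * exp 1 / \<delta>)))))^2),
                 12 / \<epsilon> + (exp 1)^2, 25}"
  shows "measure_pmf.prob (triest_base M es)
           {(S, \<tau>). \<bar>xi_ab M 3 (length es) * real_of_int \<tau> - real (card (triangles (set es)))\<bar>
                     < \<epsilon> * real (card (triangles (set es)))} > 1 - \<delta>"
    (is "measure_pmf.prob _ ?Good > _")
proof (cases "length es \<le> M")
  case True
  \<comment> \<open>Up to the capacity nothing is discarded: the sample is the whole graph, the
    scaling factor is 1 and the estimate is exact.\<close>
  then have "triest_base M es = return_pmf (with_count (set es))"
    using triest_base_eq_uniform[of es M] assms(1,2) by simp
  moreover have "with_count (set es) \<in> ?Good"
    using True assms(3,4) by (simp add: with_count_def xi_ab_def)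
  ultimately show ?thesis using assms(6) by (simp add: measure_return_pmf)
next
  case False
  define E where "E = set es"
  define t where "t = length es"
  define D where "D = real (card (triangles E))"
  define h where "h = max_tri_per_edge E"
  \<comment> \<open>One more than the bound on the number of triangles meeting a given one, as the
    greedy colouring requires.\<close>
  define K where "K = 3 * h + 1"
  define q where "q = incl_prob 3 M (card E)"
  define L where "L = ln (real K * exp 1 / \<delta>)"
  define \<Phi> where "\<Phi> = root 3 (8 / \<epsilon>\<^sup>2 * real K / D * L)"
  have finE: "finite E" by (simp add: E_def)
  have tE: "card E = t" using assms(2) by (simp add: E_def t_def valid_stream_def distinct_card)
  have Mt: "M < t" using False by (simp add: t_def)
  have D: "D > 0" using assms(3) by (simp add: D_def E_def)
  have K0: "real K > 0" "K \<ge> 1" by (simp_all add: K_def)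
  have Kh: "real K = 3 * real h + 1" by (simp add: K_def)
  have max: "real t * \<Phi> * (1 + 1/2 * (root 3 (ln (real t * \<Phi>)))\<^sup>2) \<le> real M" "25 \<le> real M"
    using assms(8) by (simp_all add: t_def \<Phi>_def E_def D_def L_def Kh h_def)
  have M25: "25 \<le> M" using max(2) by simp

  \<comment> \<open>A triangle meets itself, so \<open>h\<close> is positive. Hence
    \<open>K \<ge> 4\<close> and \<open>L \<ge> ln (4 * exp 1 / \<delta>)\<close>, which will absorb
    the factor 2 of the two-sided tail.\<close>
  have h1: "1 \<le> h"
  proof -
    obtain T where T: "T \<in> triangles E" using D by (fastforce simp: D_def card_gt_0_iff)
    then have "card {T} \<le> card {T' \<in> triangles E. T \<inter> T' \<noteq> {}}"
      using triangle_subset_card[OF T] finite_triangles[OF finE] by (intro card_mono) auto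
    then show ?thesis using card_triangles_meeting_le[OF finE T] by (simp add: h_def)
  qed
  have "4 \<le> real K" using h1 by (simp add: K_def)
  have "4 * exp 1 / \<delta> \<le> real K * exp 1 / \<delta>"
    using \<open>4 \<le> real K\<close> assms(6) by (intro divide_right_mono mult_right_mono) auto
  moreover have e1: "1 < 4 * exp 1 / \<delta>"
  proof -
    have "\<delta> < 4 * exp 1" using assms(7) exp_ge_add_one_self[of 1] by linarith
    then show ?thesis using assms(6) by simp
  qed
  ultimately have L: "ln (4 * exp 1 / \<delta>) \<le> L" "0 < ln (4 * exp 1 / \<delta>)"
    unfolding L_def by (auto intro: ln_mono)
  then have L0: "0 < L" by linarith

  have \<Phi>3: "\<Phi> ^ 3 = 8 / \<epsilon>\<^sup>2 * real K / D * L"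
    unfolding \<Phi>_def by (intro odd_real_root_pow) simp
  have \<Phi>0: "0 \<le> \<Phi>" unfolding \<Phi>_def using D L0 by simp
  have "3 / 2 * (real t * \<Phi>) \<le> real M"
    using one_and_half_le max by blast
  then have "(3 / 2 * (real t * \<Phi>)) ^ 3 \<le> real M ^ 3"
    using \<Phi>0 by (intro power_mono) auto
  \<comment> \<open>The constant 27 is the cube of \<open>3 / 2\<close> times the 8 inside
    \<open>\<Phi> ^ 3\<close>.\<close>
  then have M3: "27 * real t ^ 3 * (real K / (\<epsilon>\<^sup>2 * D)) * L \<le> real M ^ 3"
    by (simp add: power_mult_distrib \<Phi>3 power_divide field_simps)
  have q: "q * (real t * (real t - 1) * (real t - 2)) = real M * (real M - 1) * (real M - 2)"
    using incl_prob_3[of M t] M25 Mt by (simp add: q_def tE)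
  have q0: "q \<ge> 0" by (simp add: q_def incl_prob_nonneg)
  \<comment> \<open>The loss from replacing the falling factorial by a cube: the difference is
    nonnegative from \<open>M = 20\<close> on, hence for \<open>M \<ge> 25\<close>.\<close>
  have "17 / 20 * real M ^ 3 \<le> real M * (real M - 1) * (real M - 2)"
  proof -
    have "0 \<le> real M * (3 / 20 * real M * (real M - 20) + 2)"
      using M25 by (intro mult_nonneg_nonneg add_nonneg_nonneg) auto
    moreover have "real M * (3 / 20 * real M * (real M - 20) + 2) =
        real M * (real M - 1) * (real M - 2) - 17 / 20 * real M ^ 3"
      by (simp add: field_simps power3_eq_cube)
    ultimately show ?thesis by linarith
  qed
  also have "\<dots> \<le> q * real t ^ 3"
    unfolding q[symmetric] power3_eq_cube using Mt M25 q0
    by (intro mult_left_mono mult_mono) auto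
  finally have qt: "17 / 20 * (27 * real t ^ 3 * (real K / (\<epsilon>\<^sup>2 * D)) * L) \<le> q * real t ^ 3"
    by (intro order_trans[OF mult_left_mono[OF M3]]) simp
  \<comment> \<open>Here \<open>27 * 17 / 20 = 459 / 20\<close> exceeds 16, the constant in the
    exponent of the tail bound.\<close>
  have "real t ^ 3 * (16 * L * (real K / (\<epsilon>\<^sup>2 * D))) \<le> real t ^ 3 * q"
  proof -
    define z where "z = real t ^ 3 * (real K / (\<epsilon>\<^sup>2 * D)) * L"
    have "0 \<le> z" using L0 K0 D by (simp add: z_def)
    moreover have "459 / 20 * z \<le> real t ^ 3 * q" using qt by (simp add: z_def mult_ac)
    ultimately have "16 * z \<le> real t ^ 3 * q" by linarith
    then show ?thesis by (simp add: z_def mult_ac)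
  qed
  then have "16 * L * (real K / (\<epsilon>\<^sup>2 * D)) \<le> q"
    using Mt by (subst (asm) mult_le_cancel_left_pos) auto
  then have expo: "L \<le> \<epsilon>\<^sup>2 * (q * D) / (16 * real K)"
    using K0 D assms(4) by (simp add: field_simps)

  \<comment> \<open>Triangles are sets of edges, so colour classes consist of edge-disjoint
    triangles.\<close>
  obtain c :: "'v set set \<Rightarrow> nat" where c: "\<And>T. T \<in> triangles E \<Longrightarrow> c T < K"
    "\<And>T T'. T \<in> triangles E \<Longrightarrow> T' \<in> triangles E \<Longrightarrow> T \<noteq> T' \<Longrightarrow> T \<inter> T' \<noteq> {} \<Longrightarrow> c T \<noteq> c T'"
  proof (rule greedy_colouring[of "triangles E" "\<lambda>T T'. T \<inter> T' \<noteq> {}" K])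
    show "card {T' \<in> triangles E. T \<inter> T' \<noteq> {}} < K" if "T \<in> triangles E" for T
      using card_triangles_meeting_le[OF finE that] by (simp add: K_def h_def)
  qed (use finite_triangles[OF finE] in auto)
  have "avg M E (\<lambda>S. of_bool (\<epsilon> * (q * D) \<le> \<bar>real (card {T \<in> triangles E. T \<subseteq> S}) - q * D\<bar>)) \<le>
        2 * exp (- (\<epsilon>\<^sup>2 * (q * D) / (16 * real K)))"
    unfolding q_def D_def
  proof (rule avg_deviation_le[where c = c])
    show "T \<inter> T' = {}" if "T \<in> triangles E" "T' \<in> triangles E" "T \<noteq> T'" "c T = c T'" for T T'
      using c(2)[OF that(1-3)] that(4) by argo
  qed (use c(1) M25 Mt tE assms(4,5) K0 finE in
      \<open>simp_all add: finite_triangles triangle_subset_card\<close>)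
  also have "\<dots> \<le> 2 * exp (- ln (4 * exp 1 / \<delta>))"
    using expo L by simp
  also have "\<dots> = \<delta> / (2 * exp 1)"
    using assms(6) by (simp add: exp_minus)
  also have "\<dots> < \<delta>"
    using assms(6) exp_ge_add_one_self[of 1] by (simp add: field_simps)
  finally have dev: "avg M E (\<lambda>S. of_bool (\<epsilon> * (q * D) \<le> \<bar>real (card {T \<in> triangles E. T \<subseteq> S}) - q * D\<bar>)) < \<delta>" .

  have q_pos: "q > 0" and xi: "xi_ab M 3 t = 1 / q"
    using xi_ab_3[OF Mt] incl_prob_3[of M t] M25 Mt by (auto simp: q_def tE)
  \<comment> \<open>Since \<open>xi_ab M 3 t\<close> is \<open>1 / q\<close>, failure of the
    estimate is a deviation of the sampled count from its mean \<open>q * D\<close> by at least the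
    fraction \<epsilon> of that mean.\<close>
  have bad_iff: "with_count S \<in> - ?Good \<longleftrightarrow>
      \<epsilon> * (q * D) \<le> \<bar>real (card {T \<in> triangles E. T \<subseteq> S}) - q * D\<bar>" if "S \<subseteq> E" for S
  proof -
    have "\<bar>xi_ab M 3 t * Y - D\<bar> = \<bar>Y - q * D\<bar> / q" for Y :: real
    proof -
      have "xi_ab M 3 t * Y - D = (Y - q * D) / q" using q_pos by (simp add: xi field_simps)
      then show ?thesis using q_pos by (simp add: abs_divide)
    qed
    then show ?thesis using q_pos
      by (simp add: with_count_def triangles_subset[OF that] D_def[symmetric] t_def[symmetric]
          E_def[symmetric] not_less pos_le_divide_eq mult_ac)
  qed
  have U: "finite (subsets_of_card M E)" "subsets_of_card M E \<noteq> {}"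
    using finE obtain_subset_with_card_n[of M E] Mt tE by auto
  have "measure_pmf.prob (triest_base M es) (- ?Good) =
      measure_pmf.prob (pmf_of_set (subsets_of_card M E)) (with_count -` (- ?Good))"
    using triest_base_eq_uniform[of es M] False assms(1,2) by (simp add: E_def)
  also have "\<dots> = (\<Sum>S\<in>subsets_of_card M E. of_bool (with_count S \<in> - ?Good)) / real (card (subsets_of_card M E))"
    using U by (simp add: measure_pmf_of_set of_bool_def sum.If_cases Int_def vimage_def del: Compl_iff)
  also have "\<dots> = avg M E (\<lambda>S. of_bool (\<epsilon> * (q * D) \<le> \<bar>real (card {T \<in> triangles E. T \<subseteq> S}) - q * D\<bar>))"
    unfolding avg_def n_subsets[OF finE] using bad_iff
    by (intro arg_cong2[where f = "(/)"] sum.cong) (auto simp del: Compl_iff)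
  finally have "measure_pmf.prob (triest_base M es) (- ?Good) < \<delta>" using dev by linarith
  moreover have "measure_pmf.prob (triest_base M es) (- ?Good) = 1 - measure_pmf.prob (triest_base M es) ?Good"
    using measure_pmf.prob_compl[of ?Good "triest_base M es"] by (simp add: Compl_eq_Diff_UNIV)
  ultimately show ?thesis by linarith
qed

end
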